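(* Let $G$ be a graph with $n$ vertices and $m$ edges in which every vertex has even degree, and let $k$ be a positive integer. Then there is a sequence of at most $k$ exclusive vertex splits transforming $G$ into a cycle graph if and only if $k\ge m-n$.
   Context: All graphs are finite, simple and undirected. An exclusive vertex split of a vertex $v$ removes $v$ and adds two new vertices $v_1,v_2$ with $N(v_1)\cup N(v_2)=N(v)$ and $N(v_1)\cap N(v_2)=\emptyset$; no other adjacencies change. A cycle graph is a disjoint union of cycles.
   Formalization: The graph is additionally assumed to have no isolated vertices (every degree is positive and even); otherwise the claim fails, e.g. for a single vertex, where m-n=-1 but no splits ever produce a cycle graph. *)

theory Defs
  imports Main "HOL-Library.Infinite_Typeclass" "HOL-Library.Disjoint_Sets"
begin

record 'a ugraph =
  verts :: "'a set"
  edges :: "'a set set"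

definition simple_graph :: "'a ugraph \<Rightarrow> bool" where
  "simple_graph G \<longleftrightarrow>
     finite (verts G) \<and> (\<forall>e\<in>edges G. e \<subseteq> verts G \<and> card e = 2)"

definition nbhd :: "'a ugraph \<Rightarrow> 'a \<Rightarrow> 'a set" where
  "nbhd G v = {u. {v, u} \<in> edges G}"

definition degree :: "'a ugraph \<Rightarrow> 'a \<Rightarrow> nat" where
  "degree G v = card (nbhd G v)"

text \<open>
  The vertices \<open>v1\<close> and \<open>v2\<close> are fresh, so repeated splitting stays inside the vertex type only
  if that type is infinite. Since \<open>nbhd G v\<close> contains neither of them, \<open>v1\<close> and \<open>v2\<close> are
  not adjacent in \<open>H\<close>. One of the two new neighbourhoods may be empty.
\<close>

definition exclusive_split :: "'a ugraph \<Rightarrow> 'a ugraph \<Rightarrow> bool" where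
  "exclusive_split G H \<longleftrightarrow>
     simple_graph H \<and>
     (\<exists>v v1 v2. v \<in> verts G \<and> v1 \<notin> verts G \<and> v2 \<notin> verts G \<and> v1 \<noteq> v2 \<and>
        verts H = (verts G - {v}) \<union> {v1, v2} \<and>
        nbhd H v1 \<union> nbhd H v2 = nbhd G v \<and>
        nbhd H v1 \<inter> nbhd H v2 = {} \<and>
        (\<forall>x\<in>verts G - {v}. \<forall>y\<in>verts G - {v}. {x, y} \<in> edges H \<longleftrightarrow> {x, y} \<in> edges G))"

definition is_cycle :: "'a ugraph \<Rightarrow> bool" where
  "is_cycle C \<longleftrightarrow>
     (\<exists>xs. distinct xs \<and> length xs \<ge> 3 \<and> verts C = set xs \<and>
        edges C = {{xs ! i, xs ! (Suc i mod length xs)} | i. i < length xs})"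

text \<open>
  The family of cycles may be empty, so the graph without vertices is a cycle graph. A cycle has
  no isolated vertex, and splitting an isolated vertex only produces more of them, so a graph with
  a vertex of degree \<open>0\<close> can never be split into a cycle graph.
\<close>

definition cycle_graph :: "'a ugraph \<Rightarrow> bool" where
  "cycle_graph G \<longleftrightarrow>
     (\<exists>\<C>. finite \<C> \<and> (\<forall>C\<in>\<C>. is_cycle C) \<and> disjoint_family_on verts \<C> \<and>
        verts G = (\<Union>C\<in>\<C>. verts C) \<and> edges G = (\<Union>C\<in>\<C>. edges C))"

end

theory Submission
  imports Defs
begin

text \<open>
  A split keeps the degree sum, hence the number of edges, and adds one vertex. A cycle graph has as
  many edges as vertices, so exactly \<open>m - n\<close> splits are needed. Conversely, as long as \<open>m > n\<close>
  some vertex has degree at least \<open>4\<close>; separating two of its neighbours from the others keeps all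
  degrees even and positive. Once \<open>m = n\<close> the graph is \<open>2\<close>-regular, and a longest path in a
  \<open>2\<close>-regular graph closes up to a cycle that can be removed.
\<close>

section \<open>Neighbourhoods, incident edges and the handshake identity\<close>

lemma nbhd_sym: "u \<in> nbhd G v \<longleftrightarrow> v \<in> nbhd G u"
  by (simp add: nbhd_def insert_commute)

lemma nbhd_subset: "simple_graph G \<Longrightarrow> nbhd G v \<subseteq> verts G - {v}"
  by (force simp: simple_graph_def nbhd_def)

lemma finite_nbhd: "simple_graph G \<Longrightarrow> finite (nbhd G v)"
  by (meson finite_Diff finite_subset nbhd_subset simple_graph_def)

lemma finite_edges: "simple_graph G \<Longrightarrow> finite (edges G)"
  by (rule finite_subset[of _ "Pow (verts G)"]) (auto simp: simple_graph_def)

lemma edge_at: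
  assumes "simple_graph G" "e \<in> edges G" "v \<in> e"
  obtains u where "e = {v, u}" "u \<in> nbhd G v"
proof -
  have "card e = 2"
    using assms by (auto simp: simple_graph_def)
  then obtain u where "e = {v, u}"
    using assms(3) by (auto simp: card_2_iff)
  then show thesis
    using assms(2) that by (auto simp: nbhd_def)
qed

lemma card_incident_edges:
  assumes "simple_graph G"
  shows "card {e \<in> edges G. v \<in> e} = degree G v"
proof -
  have "bij_betw (\<lambda>u. {v, u}) (nbhd G v) {e \<in> edges G. v \<in> e}"
    unfolding bij_betw_def
    by (auto simp: inj_on_def doubleton_eq_iff nbhd_def elim: edge_at[OF assms])
  then show ?thesis
    by (simp add: bij_betw_same_card degree_def)
qed

text \<open>Double counting of incident pairs of a vertex and an edge: every edge contributes its
  two ends.\<close>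

lemma handshake:
  assumes "simple_graph G"
  shows "(\<Sum>v\<in>verts G. degree G v) = 2 * card (edges G)"
proof -
  have "{v \<in> verts G. v \<in> e} = e" "card e = 2" if "e \<in> edges G" for e
    using that assms by (auto simp: simple_graph_def)
  then have "(\<Sum>v\<in>verts G. card {e \<in> edges G. v \<in> e}) = 2 * card (edges G)"
    using assms finite_edges[OF assms] by (intro sum_multicount) (auto simp: simple_graph_def)
  then show ?thesis
    by (simp add: card_incident_edges[OF assms])
qed

section \<open>Effect of splits on degrees and on the numbers of vertices and edges\<close>

text \<open>If \<open>x\<close> is adjacent to \<open>v\<close>, then \<open>v\<close> is replaced
  in its neighbourhood by exactly one of \<open>v1\<close> and \<open>v2\<close>: at least one by
  \<open>nU\<close>, at most one by \<open>nI\<close>. Otherwise the neighbourhood of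
  \<open>x\<close> does not change.\<close>

lemma split_degree:
  assumes G: "simple_graph G" and H: "simple_graph H"
    and fresh: "v1 \<notin> verts G" "v2 \<notin> verts G" "v1 \<noteq> v2"
    and vH: "verts H = (verts G - {v}) \<union> {v1, v2}"
    and nU: "nbhd H v1 \<union> nbhd H v2 = nbhd G v" and nI: "nbhd H v1 \<inter> nbhd H v2 = {}"
    and old: "\<forall>x\<in>verts G - {v}. \<forall>y\<in>verts G - {v}. {x, y} \<in> edges H \<longleftrightarrow> {x, y} \<in> edges G"
    and x: "x \<in> verts G - {v}"
  shows "degree H x = degree G x"
proof -
  \<comment> \<open>A vertex \<open>y\<close> outside \<open>verts G - {v}\<close> lies on neither
    side, since neighbours are vertices of the respective graph; for the other \<open>y\<close> the
    assumption \<open>old\<close> decides.\<close>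
  have rest: "nbhd H x - {v1, v2} = nbhd G x - {v}"
  proof (rule set_eqI)
    fix y
    show "y \<in> nbhd H x - {v1, v2} \<longleftrightarrow> y \<in> nbhd G x - {v}"
      using old x vH fresh nbhd_subset[OF G, of x] nbhd_subset[OF H, of x]
      by (cases "y \<in> verts G - {v}") (auto simp: nbhd_def)
  qed
  show ?thesis
  proof (cases "v \<in> nbhd G x")
    case False
    then have "v1 \<notin> nbhd H x" "v2 \<notin> nbhd H x"
      using nU nbhd_sym by fast+
    with False rest show ?thesis
      by (simp add: degree_def)
  next
    case True
    then have "x \<in> nbhd H v1 \<union> nbhd H v2"
      using nU nbhd_sym by fast
    then have "v1 \<in> nbhd H x \<longleftrightarrow> v2 \<notin> nbhd H x"
      using nI by (subst (1 2) nbhd_sym) blast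
    then have "\<exists>w\<in>{v1, v2}. nbhd H x = insert w (nbhd H x - {v1, v2})"
      using fresh(3) by (cases "v1 \<in> nbhd H x") auto
    then obtain w where w: "w \<in> {v1, v2}" "nbhd H x = insert w (nbhd G x - {v})"
      unfolding rest by blast
    \<comment> \<open>Since \<open>w\<close> is fresh, inserting it raises the cardinality by one,
      which makes up for the removal of \<open>v\<close>.\<close>
    then have "w \<notin> nbhd G x - {v}"
      using nbhd_subset[OF G] fresh by auto
    then show ?thesis
      using w(2) finite_nbhd[OF G, of x] card_Suc_Diff1[OF finite_nbhd[OF G] True]
      by (simp add: degree_def del: card_Diff_singleton card_Diff_insert)
  qed
qed

text \<open>The disjoint neighbourhoods of \<open>v1\<close> and \<open>v2\<close> have degrees
  adding up to that of \<open>v\<close>, and all other degrees persist, so \<open>handshake\<close>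
  turns the equal degree sums into equal edge counts.\<close>

lemma exclusive_split_card:
  assumes G: "simple_graph G" and GH: "exclusive_split G H"
  shows "simple_graph H \<and> card (verts H) = Suc (card (verts G)) \<and> card (edges H) = card (edges G)"
proof -
  obtain v v1 v2 where H: "simple_graph H" and v: "v \<in> verts G"
    and fresh: "v1 \<notin> verts G" "v2 \<notin> verts G" "v1 \<noteq> v2"
    and vH: "verts H = (verts G - {v}) \<union> {v1, v2}"
    and nU: "nbhd H v1 \<union> nbhd H v2 = nbhd G v" and nI: "nbhd H v1 \<inter> nbhd H v2 = {}"
    and old: "\<forall>x\<in>verts G - {v}. \<forall>y\<in>verts G - {v}. {x, y} \<in> edges H \<longleftrightarrow> {x, y} \<in> edges G"
    using GH unfolding exclusive_split_def by blast
  have fin: "finite (verts G)"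
    using G by (simp add: simple_graph_def)
  have "degree H v1 + degree H v2 = degree G v"
    using card_Un_disjoint[OF finite_nbhd[OF H] finite_nbhd[OF H] nI] by (simp add: degree_def nU)
  moreover have "(\<Sum>x\<in>verts G - {v}. degree H x) = (\<Sum>x\<in>verts G - {v}. degree G x)"
    using split_degree[OF G H fresh vH nU nI old] by (rule sum.cong[OF refl])
  ultimately have "(\<Sum>x\<in>verts H. degree H x) = (\<Sum>x\<in>verts G. degree G x)"
    using fin v fresh by (simp add: vH sum.remove[of "verts G" v])
  then have "card (edges H) = card (edges G)"
    by (simp add: handshake G H)
  moreover have "card (verts H) = Suc (card (verts G))"
    using card_Suc_Diff1[OF fin v] fin fresh by (simp add: vH del: card_Diff_insert card_Diff_singleton)
  ultimately show ?thesis
    using H by simp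
qed

lemma exclusive_splits_card:
  assumes "(exclusive_split ^^ i) G H" "simple_graph G"
  shows "simple_graph H \<and> card (verts H) = card (verts G) + i \<and> card (edges H) = card (edges G)"
  using assms
proof (induction i arbitrary: H)
  case (Suc i)
  then obtain K where "(exclusive_split ^^ i) G K" "exclusive_split K H"
    by auto
  with Suc.IH[of K] Suc.prems(2) exclusive_split_card[of K H] show ?case
    by simp
qed simp

section \<open>Edge and vertex counts of cycle graphs\<close>

text \<open>Sending an index to the edge that starts there is injective. The last conjunct is what
  makes vertex-disjoint cycles edge-disjoint.\<close>

lemma is_cycle_card:
  assumes "is_cycle C"
  shows "finite (verts C) \<and> finite (edges C) \<and> card (edges C) = card (verts C)
    \<and> (\<forall>e\<in>edges C. e \<subseteq> verts C \<and> e \<noteq> {})"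
proof -
  obtain xs where xs: "distinct xs" "length xs \<ge> 3" "verts C = set xs"
    "edges C = {{xs ! i, xs ! (Suc i mod length xs)} | i. i < length xs}"
    using assms unfolding is_cycle_def by blast
  let ?n = "length xs" and ?f = "\<lambda>i. {xs ! i, xs ! (Suc i mod length xs)}"
  have im: "edges C = ?f ` {..<?n}"
    unfolding xs(4) by auto
  have less: "Suc i mod ?n < ?n" for i
    using xs(2) by (intro mod_less_divisor) linarith
  have "inj_on ?f {..<?n}"
  proof (rule inj_onI)
    fix i j assume ij: "i \<in> {..<?n}" "j \<in> {..<?n}" "?f i = ?f j"
    \<comment> \<open>Two distinct indices with the same edge would be cyclic successors of each
      other, which is impossible for length at least 3.\<close>
    have "i = j \<or> i = Suc j mod ?n \<and> j = Suc i mod ?n"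
      using ij less by (auto simp: doubleton_eq_iff nth_eq_iff_index_eq[OF xs(1)])
    then show "i = j"
      using ij(1,2) xs(2) by (auto simp: mod_Suc split: if_splits)
  qed
  then have "card (edges C) = ?n"
    by (simp add: im card_image)
  moreover have "\<forall>e\<in>edges C. e \<subseteq> verts C \<and> e \<noteq> {}"
    using less by (auto simp: im xs(3))
  ultimately show ?thesis
    by (simp add: xs(3) im distinct_card[OF xs(1)])
qed

text \<open>A common edge of two cycles would be a nonempty subset of both vertex sets. Hence both
  counts are sums over the cycles, and they agree term by term.\<close>

lemma cycle_graph_card:
  assumes "cycle_graph G"
  shows "card (edges G) = card (verts G)"
proof -
  obtain \<C> where fin: "finite \<C>" and cyc': "\<forall>C\<in>\<C>. is_cycle C"
    and disj: "disjoint_family_on verts \<C>"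
    and G: "verts G = (\<Union>C\<in>\<C>. verts C)" "edges G = (\<Union>C\<in>\<C>. edges C)"
    using assms unfolding cycle_graph_def by blast
  have cyc: "is_cycle C" if "C \<in> \<C>" for C
    using cyc' that by blast
  have disjv: "verts C \<inter> verts D = {}" if "C \<in> \<C>" "D \<in> \<C>" "C \<noteq> D" for C D
    using disj that by (simp add: disjoint_family_on_def)
  have disje: "edges C \<inter> edges D = {}" if "C \<in> \<C>" "D \<in> \<C>" "C \<noteq> D" for C D
  proof -
    have "e \<subseteq> verts C \<inter> verts D \<and> e \<noteq> {}" if "e \<in> edges C \<inter> edges D" for e
      using that is_cycle_card cyc \<open>C \<in> \<C>\<close> \<open>D \<in> \<C>\<close> by (metis Int_iff le_inf_iff)
    then show ?thesis
      using disjv[OF that] by blast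
  qed
  have "card (edges G) = (\<Sum>C\<in>\<C>. card (edges C))"
    unfolding G using fin cyc is_cycle_card disje by (intro card_UN_disjoint) auto
  also have "\<dots> = (\<Sum>C\<in>\<C>. card (verts C))"
    using cyc is_cycle_card by (intro sum.cong) auto
  also have "\<dots> = card (verts G)"
    unfolding G using fin cyc is_cycle_card disjv by (intro card_UN_disjoint[symmetric]) auto
  finally show ?thesis .
qed

section \<open>Decomposition of 2-regular graphs into cycles\<close>

text \<open>All neighbours of the first vertex of a longest path lie on the path. The neighbour
  other than the second vertex must be the last vertex, because an inner vertex would acquire a
  third neighbour.\<close>

lemma two_regular_closed_path:
  assumes G: "simple_graph G" and reg: "\<And>v. v \<in> verts G \<Longrightarrow> degree G v = 2"
    and ne: "verts G \<noteq> {}"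
  obtains xs where "distinct xs" "length xs \<ge> 3" "set xs \<subseteq> verts G"
    "\<And>i. i < length xs \<Longrightarrow> {xs ! i, xs ! (Suc i mod length xs)} \<in> edges G"
proof -
  define path where "path xs \<longleftrightarrow> distinct xs \<and> set xs \<subseteq> verts G \<and>
    (\<forall>i. Suc i < length xs \<longrightarrow> {xs ! i, xs ! Suc i} \<in> edges G)" for xs
  have finV: "finite (verts G)"
    using G by (simp add: simple_graph_def)
  obtain v where v: "v \<in> verts G"
    using ne by blast
  have "path [v]"
    using v by (simp add: path_def)
  \<comment> \<open>The vertices of a path are distinct, so lengths are bounded and a longest path
    exists.\<close>
  moreover have "\<forall>ys. path ys \<longrightarrow> length ys < Suc (card (verts G))"
    using card_mono[OF finV] distinct_card by (metis path_def less_Suc_eq_le)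
  ultimately obtain xs where p: "path xs" and max: "\<forall>ys. path ys \<longrightarrow> length ys \<le> length xs"
    using Lattices_Big.ex_has_greatest_nat[of path "[v]" length] by blast
  have "xs \<noteq> []"
    using max \<open>path [v]\<close> by auto
  then have x0: "xs ! 0 \<in> verts G"
    using p by (auto simp: path_def)
  \<comment> \<open>A neighbour off the path could be put in front of it, giving a longer
    path.\<close>
  have closed: "nbhd G (xs ! 0) \<subseteq> set xs"
  proof (rule ccontr)
    assume "\<not> nbhd G (xs ! 0) \<subseteq> set xs"
    then obtain z where z: "z \<in> nbhd G (xs ! 0)" "z \<notin> set xs"
      by blast
    have "{(z # xs) ! i, (z # xs) ! Suc i} \<in> edges G" if "Suc i < length (z # xs)" for i
      using that p z(1) by (cases i) (auto simp: path_def nbhd_def insert_commute)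
    then have "path (z # xs)"
      using p z nbhd_subset[OF G] by (auto simp: path_def)
    then show False
      using max by fastforce
  qed
  have "card (nbhd G (xs ! 0)) = 2"
    using reg[OF x0] by (simp add: degree_def)
  \<comment> \<open>A singleton cannot hold two neighbours; this argument also covers a one-vertex
    path, where \<open>xs ! 1\<close> is unspecified.\<close>
  then have "\<not> nbhd G (xs ! 0) \<subseteq> {xs ! 1}"
    using card_mono[of "{xs ! 1}" "nbhd G (xs ! 0)"] by auto
  then obtain y where y: "y \<in> nbhd G (xs ! 0)" "y \<noteq> xs ! 1"
    by blast
  then obtain j where j: "j < length xs" "y = xs ! j"
    using closed by (metis in_set_conv_nth subsetD)
  have "xs ! j \<noteq> xs ! 0"
    using y j nbhd_subset[OF G] by blast
  then have j2: "j \<ge> 2"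
    using y j by (cases j; cases "j - 1") auto
  \<comment> \<open>Otherwise \<open>xs ! j\<close> is adjacent to the vertices at positions
    \<open>0\<close>, \<open>j - 1\<close> and \<open>Suc j\<close>, which are distinct because
    \<open>j\<close> is at least 2.\<close>
  have last: "Suc j = length xs"
  proof (rule ccontr)
    assume "Suc j \<noteq> length xs"
    with j have j': "Suc j < length xs"
      by simp
    have "{xs ! (j - 1), xs ! Suc (j - 1)} \<in> edges G" "{xs ! j, xs ! Suc j} \<in> edges G"
      using p j j' j2 unfolding path_def
      by (metis Suc_lessD less_le_trans Suc_pred' pos2, blast)
    then have "{xs ! 0, xs ! (j - 1), xs ! Suc j} \<subseteq> nbhd G (xs ! j)"
      using y j j2 by (auto simp: nbhd_def insert_commute)
    moreover have "card {xs ! 0, xs ! (j - 1), xs ! Suc j} = 3"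
    proof -
      have "xs ! 0 \<noteq> xs ! (j - 1)" "xs ! 0 \<noteq> xs ! Suc j" "xs ! (j - 1) \<noteq> xs ! Suc j"
        using p j' j2 \<open>xs \<noteq> []\<close> by (auto simp: path_def nth_eq_iff_index_eq)
      then show ?thesis
        by simp
    qed
    ultimately have "3 \<le> degree G (xs ! j)"
      using card_mono[OF finite_nbhd[OF G]] unfolding degree_def by metis
    moreover have "xs ! j \<in> verts G"
      using p j by (auto simp: path_def)
    ultimately show False
      using reg by fastforce
  qed
  have "{xs ! i, xs ! (Suc i mod length xs)} \<in> edges G" if "i < length xs" for i
  proof (cases "Suc i = length xs")
    case True
    then have "i = j"
      using last by simp
    then show ?thesis
      using y j True by (simp add: nbhd_def insert_commute)
  next
    case False
    then show ?thesis
      using that p by (simp add: path_def)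
  qed
  then show thesis
    using that[of xs] p j2 last by (auto simp: path_def)
qed

text \<open>The predecessor and the successor on the cycle already exhaust the two neighbours of
  each vertex, so no other edge touches the cycle and it can be cut off as a component.\<close>

lemma two_regular_cycle_edges:
  assumes G: "simple_graph G" and reg: "\<And>v. v \<in> verts G \<Longrightarrow> degree G v = 2"
    and xs: "distinct xs" "length xs \<ge> 3" "set xs \<subseteq> verts G"
    and cyc: "\<And>i. i < length xs \<Longrightarrow> {xs ! i, xs ! (Suc i mod length xs)} \<in> edges G"
  shows "{e \<in> edges G. e \<inter> set xs \<noteq> {}} = {{xs ! i, xs ! (Suc i mod length xs)} | i. i < length xs}"
    (is "?L = ?R")
proof
  show "?R \<subseteq> ?L"
    using cyc by auto
  show "?L \<subseteq> ?R"
  proof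
    fix e assume "e \<in> ?L"
    then obtain i where e: "e \<in> edges G" and i: "i < length xs" "xs ! i \<in> e"
      by (auto simp: in_set_conv_nth)
    obtain u where u: "e = {xs ! i, u}" "u \<in> nbhd G (xs ! i)"
      using edge_at[OF G e i(2)] .
    \<comment> \<open>The cyclic predecessor of \<open>i\<close>; index \<open>0\<close> is treated
      apart because \<open>0 - 1\<close> is \<open>0\<close> on \<open>nat\<close>.\<close>
    define p where "p = (if i = 0 then length xs - 1 else i - 1)"
    have p: "p < length xs" "Suc p mod length xs = i"
      using i xs(2) by (auto simp: p_def)
    let ?s = "Suc i mod length xs"
    have s: "?s < length xs"
      using i by (intro mod_less_divisor) linarith
    \<comment> \<open>Predecessor and successor would coincide on a cycle of length 2; here the
      length is at least 3.\<close>
    have "p \<noteq> ?s"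
      using i xs(2) by (auto simp: p_def mod_Suc)
    then have "card {xs ! p, xs ! ?s} = 2"
      using p s xs(1) by (simp add: nth_eq_iff_index_eq)
    moreover have "card (nbhd G (xs ! i)) = 2"
      using reg[of "xs ! i"] i(1) xs(3) nth_mem[OF i(1)] by (auto simp: degree_def subset_iff)
    moreover have "{xs ! p, xs ! ?s} \<subseteq> nbhd G (xs ! i)"
      using cyc[OF p(1)] cyc[OF i(1)] p(2) by (auto simp: nbhd_def insert_commute)
    ultimately have "nbhd G (xs ! i) = {xs ! p, xs ! ?s}"
      using card_subset_eq[OF finite_nbhd[OF G]] by metis
    then consider "u = xs ! p" | "u = xs ! ?s"
      using u by blast
    then show "e \<in> ?R"
    proof cases
      case 1
      then have "e = {xs ! p, xs ! (Suc p mod length xs)}"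
        using u p by auto
      then show ?thesis
        using p by blast
    next
      case 2
      then show ?thesis
        using u i by blast
    qed
  qed
qed

text \<open>Induction on the number of vertices: the cycle \<open>C\<close> is split off and the
  rest \<open>K\<close> is again 2-regular.\<close>

lemma two_regular_cycle_graph:
  assumes "simple_graph G" "\<forall>v\<in>verts G. degree G v = 2"
  shows "cycle_graph G"
  using assms
proof (induction "card (verts G)" arbitrary: G rule: less_induct)
  case less
  have G: "simple_graph G" and reg: "\<And>v. v \<in> verts G \<Longrightarrow> degree G v = 2"
    using less.prems by auto
  have fin: "finite (verts G)"
    using G by (simp add: simple_graph_def)
  show ?case
  proof (cases "verts G = {}")
    case True
    then have "edges G = {}"
      using G by (auto simp: simple_graph_def)
    then show ?thesis
      using True by (auto simp: cycle_graph_def disjoint_family_on_def intro!: exI[of _ "{}"])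
  next
    case False
    obtain xs where xs: "distinct xs" "length xs \<ge> 3" "set xs \<subseteq> verts G"
      "\<And>i. i < length xs \<Longrightarrow> {xs ! i, xs ! (Suc i mod length xs)} \<in> edges G"
      using two_regular_closed_path[OF G reg False] by blast
    note cut = two_regular_cycle_edges[OF G reg xs]
    define C where "C = \<lparr>verts = set xs, edges = {e \<in> edges G. e \<inter> set xs \<noteq> {}}\<rparr>"
    define K where "K = \<lparr>verts = verts G - set xs, edges = {e \<in> edges G. e \<inter> set xs = {}}\<rparr>"
    have C: "is_cycle C"
      unfolding is_cycle_def by (rule exI[of _ xs]) (simp add: C_def cut xs)
    \<comment> \<open>No edge joins the cycle to the rest, so the vertices of \<open>K\<close> keep
      all their neighbours.\<close>
    have within: "e \<subseteq> set xs" if "e \<in> edges G" "e \<inter> set xs \<noteq> {}" for e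
      using is_cycle_card[OF C] that by (auto simp: C_def)
    have "nbhd K v = nbhd G v" if "v \<in> verts K" for v
    proof -
      have "{v, u} \<inter> set xs = {}" if "u \<in> nbhd G v" for u
        using within[of "{v, u}"] that \<open>v \<in> verts K\<close> by (auto simp: nbhd_def K_def)
      then show ?thesis
        by (auto simp: nbhd_def K_def)
    qed
    then have "\<forall>v\<in>verts K. degree K v = 2"
      using reg by (simp add: degree_def K_def)
    moreover have "simple_graph K"
      using G by (auto simp: simple_graph_def K_def)
    moreover have "card (verts K) < card (verts G)"
    proof (rule psubset_card_mono[OF fin])
      show "verts K \<subset> verts G"
        using xs(2,3) by (cases xs) (auto simp: K_def)
    qed
    ultimately have "cycle_graph K"
      using less.hyps by blast
    then obtain \<C> where \<C>: "finite \<C>" "\<forall>C\<in>\<C>. is_cycle C" "disjoint_family_on verts \<C>"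
      "verts K = (\<Union>C\<in>\<C>. verts C)" "edges K = (\<Union>C\<in>\<C>. edges C)"
      unfolding cycle_graph_def by blast
    have VG: "verts G = verts C \<union> verts K" and "verts C \<inter> verts K = {}"
      and EG: "edges G = edges C \<union> edges K"
      using xs(3) by (auto simp: C_def K_def)
    \<comment> \<open>The members of \<open>\<C>\<close> have their vertices in
      \<open>verts K\<close>, which is disjoint from \<open>verts C\<close>.\<close>
    then have "disjoint_family_on verts (insert C \<C>)"
      using \<C>(3,4) by (fastforce simp: disjoint_family_on_def)
    then show ?thesis
      unfolding cycle_graph_def
      using \<C> C VG EG by (intro exI[of _ "insert C \<C>"]) auto
  qed
qed

section \<open>Construction of the splits\<close>

text \<open>The new vertices receive degrees \<open>2\<close> and \<open>degree G v - 2\<close>. An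
  even degree above 2 is at least 4, so both are even and nonzero.\<close>

lemma split_off_two_neighbours:
  fixes G :: "'a::infinite ugraph"
  assumes G: "simple_graph G" and even: "\<forall>x\<in>verts G. even (degree G x)"
    and pos: "\<forall>x\<in>verts G. degree G x \<noteq> 0"
    and v: "v \<in> verts G" "degree G v > 2"
  obtains H where "exclusive_split G H" "\<forall>x\<in>verts H. even (degree H x)"
    "\<forall>x\<in>verts H. degree H x \<noteq> 0"
proof -
  have fin: "finite (verts G)"
    using G by (simp add: simple_graph_def)
  obtain v1 where v1: "v1 \<notin> verts G"
    using ex_new_if_finite[OF infinite_UNIV fin] by blast
  obtain v2 where v2: "v2 \<notin> insert v1 (verts G)"
    using ex_new_if_finite[OF infinite_UNIV] fin by (metis finite_insert)
  obtain A where A: "A \<subseteq> nbhd G v" "card A = 2"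
    using v(2) obtain_subset_with_card_n[of 2 "nbhd G v"] by (auto simp: degree_def)
  define B where "B = nbhd G v - A"
  have AB: "A \<union> B = nbhd G v" "A \<inter> B = {}"
    using A(1) by (auto simp: B_def)
  have sub: "A \<union> B \<subseteq> verts G - {v}"
    using AB(1) nbhd_subset[OF G] by simp
  define H where "H = \<lparr>verts = (verts G - {v}) \<union> {v1, v2},
    edges = {e \<in> edges G. v \<notin> e} \<union> (\<lambda>u. {v1, u}) ` A \<union> (\<lambda>u. {v2, u}) ` B\<rparr>"
  \<comment> \<open>No old edge contains a fresh vertex; hence the neighbourhoods of
    \<open>v1\<close> and \<open>v2\<close> are exactly \<open>A\<close> and
    \<open>B\<close>.\<close>
  have old1: "v1 \<notin> e" "v2 \<notin> e" if "e \<in> edges G" for e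
    using that G v1 v2 by (auto simp: simple_graph_def)
  have H: "simple_graph H"
    using G sub v1 v2 by (auto simp: simple_graph_def H_def card_2_iff')
  have n1: "nbhd H v1 = A" and n2: "nbhd H v2 = B"
    using v1 v2 sub old1 by (auto simp: nbhd_def H_def doubleton_eq_iff)
  have old: "\<forall>x\<in>verts G - {v}. \<forall>y\<in>verts G - {v}. {x, y} \<in> edges H \<longleftrightarrow> {x, y} \<in> edges G"
    using v1 v2 by (auto simp: H_def doubleton_eq_iff)
  have vH: "verts H = (verts G - {v}) \<union> {v1, v2}"
    by (simp add: H_def)
  have nU: "nbhd H v1 \<union> nbhd H v2 = nbhd G v" and nI: "nbhd H v1 \<inter> nbhd H v2 = {}"
    using AB by (simp_all add: n1 n2)
  have fresh: "v1 \<notin> verts G" "v2 \<notin> verts G" "v1 \<noteq> v2"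
    using v1 v2 by auto
  have "degree H x = degree G x" if "x \<in> verts G - {v}" for x
    using split_degree[OF G H fresh vH nU nI old that] .
  moreover have "degree H v1 = 2"
    using A by (simp add: degree_def n1)
  moreover have "degree H v2 = degree G v - 2"
    using A finite_nbhd[OF G] by (simp add: degree_def n2 B_def card_Diff_subset finite_subset)
  ultimately have "\<forall>x\<in>verts H. even (degree H x) \<and> degree H x \<noteq> 0"
    using even pos v by (auto simp: vH)
  moreover have "exclusive_split G H"
    unfolding exclusive_split_def using H v(1) fresh vH nU nI old by blast
  ultimately show thesis
    using that by blast
qed

text \<open>Induction on the surplus of edges over vertices, which each split lowers by one while
  the degree conditions survive.\<close>

lemma even_graph_splits_to_cycle_graph:
  fixes G :: "'a::infinite ugraph"
  assumes "simple_graph G" "\<forall>v\<in>verts G. even (degree G v)" "\<forall>v\<in>verts G. degree G v \<noteq> 0"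
  shows "\<exists>H. (exclusive_split ^^ (card (edges G) - card (verts G))) G H \<and> cycle_graph H"
  using assms
proof (induction "card (edges G) - card (verts G)" arbitrary: G)
  case 0
  have two: "2 \<le> degree G v" if "v \<in> verts G" for v
    using 0(3,4) that by (cases "degree G v = 1") force+
  have fin: "finite (verts G)"
    using 0(2) by (simp add: simple_graph_def)
  \<comment> \<open>A zero truncated difference means at most as many edges as vertices. All degrees
    are at least 2, so a single larger one would push the degree sum above twice the number of
    vertices.\<close>
  have "degree G v = 2" if v: "v \<in> verts G" for v
  proof (rule ccontr)
    assume "degree G v \<noteq> 2"
    then have "(\<Sum>v\<in>verts G. 2) < (\<Sum>v\<in>verts G. degree G v)"
      using two v fin by (intro sum_strict_mono_ex1) (auto intro!: bexI[of _ v] simp: order.strict_iff_order)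
    then show False
      using 0(1) handshake[OF 0(2)] by simp
  qed
  then have "cycle_graph G"
    using two_regular_cycle_graph[OF 0(2)] by blast
  moreover have "(exclusive_split ^^ (card (edges G) - card (verts G))) G G"
    by (simp flip: 0(1))
  ultimately show ?case
    by blast
next
  case (Suc d)
  \<comment> \<open>There are more edges than vertices here, so the average degree exceeds
    2.\<close>
  have "\<exists>v\<in>verts G. degree G v > 2"
  proof (rule ccontr)
    assume "\<not> (\<exists>v\<in>verts G. degree G v > 2)"
    then have "(\<Sum>v\<in>verts G. degree G v) \<le> (\<Sum>v\<in>verts G. 2)"
      by (intro sum_mono) (auto simp: not_less)
    then show False
      using Suc(2) handshake[OF Suc(3)] by simp
  qed
  then obtain K where K: "exclusive_split G K" "\<forall>x\<in>verts K. even (degree K x)"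
    "\<forall>x\<in>verts K. degree K x \<noteq> 0"
    using split_off_two_neighbours[OF Suc(3-5)] by blast
  have cK: "simple_graph K" "card (edges K) - card (verts K) = d"
    using exclusive_split_card[OF Suc(3) K(1)] Suc(2) by auto
  then obtain H where "(exclusive_split ^^ d) K H" "cycle_graph H"
    using Suc(1)[of K] K by auto
  then show ?case
    \<comment> \<open>The new split comes first in the sequence, since the induction hypothesis
      starts from \<open>K\<close>.\<close>
    using relpowp_Suc_I2[of exclusive_split G K d H] K(1) Suc(2) by metis
qed

theorem theorem4:
  fixes G :: "'a::infinite ugraph" and n m k :: nat
  assumes "simple_graph G"
    and "n = card (verts G)"
    and "m = card (edges G)"
    and "\<forall>v\<in>verts G. even (degree G v)"
    and "\<forall>v\<in>verts G. degree G v \<noteq> 0"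
    and "k > 0"
  shows "(\<exists>i\<le>k. \<exists>H. (exclusive_split ^^ i) G H \<and> cycle_graph H) \<longleftrightarrow>
         int k \<ge> int m - int n"
proof
  assume "\<exists>i\<le>k. \<exists>H. (exclusive_split ^^ i) G H \<and> cycle_graph H"
  then obtain i H where "i \<le> k" "(exclusive_split ^^ i) G H" "cycle_graph H"
    by blast
  \<comment> \<open>After \<open>i\<close> splits there are \<open>n + i\<close> vertices and still
    \<open>m\<close> edges, and these numbers agree in a cycle graph.\<close>
  then have "m = n + i"
    using exclusive_splits_card[of i G H] cycle_graph_card[of H] assms(1-3) by simp
  then show "int k \<ge> int m - int n"
    using \<open>i \<le> k\<close> by simp
next
  assume "int k \<ge> int m - int n"
  \<comment> \<open>The truncated difference on \<open>nat\<close> is the number of splits that the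
    construction uses.\<close>
  then have "m - n \<le> k"
    by simp
  moreover have "\<exists>H. (exclusive_split ^^ (m - n)) G H \<and> cycle_graph H"
    using even_graph_splits_to_cycle_graph[OF assms(1,4,5)] assms(2,3) by simp
  ultimately show "\<exists>i\<le>k. \<exists>H. (exclusive_split ^^ i) G H \<and> cycle_graph H"
    by blast
qed

end
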